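(* Let $a,b$ be co-prime integers with $1<a<b$, and let $u=u_{(a,b)}$ and $v=v_{(a,b)}$ be the sequences defined by $u_0=v_0=\phi_{(a,b)}(1)$ and, for $i\in\mathbb{N}$, $$(u_{i+1},v_{i+1})=\begin{cases}(u_i,\,u_iv_i)&\text{if }u_iv_i<a,\\ (\tfrac1a u_iv_i,\,v_i)&\text{if }a\le u_iv_i.\end{cases}$$ Then the set $\{u_i : i\in\mathbb{N}\}$ is the set of all the minimum record holders of $\mathcal{F}_{(a,b)}$, and the set $\{v_i : i\in\mathbb{N}\}$ is the set of all the maximum record holders of $\mathcal{F}_{(a,b)}$.
   Context: $\mathbb{N}=\{0,1,2,\dots\}$. For co-prime integers $1<a<b$ and $p\in\mathbb{N}$, let $q=\lceil p\log b/\log a\rceil$ be the smallest nonnegative integer with $1\le a^q/b^p$. Then $q\ge p$. Put $d_{(a,b)}(p)=q-p$, $\phi_{(a,b)}(p)=\frac{a^{p+d_{(a,b)}(p)}}{b^p}$ and $\mathcal{F}_{(a,b)}=\{\phi_{(a,b)}(p):p\in\mathbb{N}\}$. A minimum record holder is any $\phi_{(a,b)}(p)$, $p\ge1$, such that $\phi_{(a,b)}(p)=\inf\{\phi_{(a,b)}(p') : 1\le p'\le p\}$. A maximum record holder is any $\phi_{(a,b)}(p)$, $p\ge1$, such that $\phi_{(a,b)}(p)=\sup\{\phi_{(a,b)}(p') : 1\le p'\le p\}$. (The value $\phi_{(a,b)}(0)=1$ is not considered.) *)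

theory Defs
  imports Complex_Main
begin

definition q_exp :: "int \<Rightarrow> int \<Rightarrow> nat \<Rightarrow> nat" where
  "q_exp a b p = (LEAST q. 1 \<le> real_of_int a ^ q / real_of_int b ^ p)"

lemma one_le_quot_iff:
  assumes "1 < a" "a < b"
  shows "1 \<le> real_of_int a ^ q / real_of_int b ^ p
    \<longleftrightarrow> \<lceil>real p * ln (real_of_int b) / ln (real_of_int a)\<rceil> \<le> int q"
proof -
  have a: "real_of_int a > 1" and b: "real_of_int b > 1" using assms by auto
  have "1 \<le> real_of_int a ^ q / real_of_int b ^ p \<longleftrightarrow> real_of_int b ^ p \<le> real_of_int a ^ q"
    using b by (simp add: field_simps)
  also have "\<dots> \<longleftrightarrow> ln (real_of_int b ^ p) \<le> ln (real_of_int a ^ q)"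
    using a b by (subst ln_le_cancel_iff) auto
  also have "\<dots> \<longleftrightarrow> real p * ln (real_of_int b) \<le> real q * ln (real_of_int a)"
    using a b by (simp add: ln_realpow)
  also have "\<dots> \<longleftrightarrow> real p * ln (real_of_int b) / ln (real_of_int a) \<le> real q"
    using a by (simp add: pos_divide_le_eq)
  also have "\<dots> \<longleftrightarrow> \<lceil>real p * ln (real_of_int b) / ln (real_of_int a)\<rceil> \<le> int q"
    by (simp add: ceiling_le_iff)
  finally show ?thesis .
qed

lemma q_exp_eq_ceiling:
  assumes "1 < a" "a < b"
  shows "int (q_exp a b p) = \<lceil>real p * ln (real_of_int b) / ln (real_of_int a)\<rceil>"
proof -
  let ?c = "\<lceil>real p * ln (real_of_int b) / ln (real_of_int a)\<rceil>"
  have "0 \<le> real p * ln (real_of_int b) / ln (real_of_int a)"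
    using assms by simp
  then have c: "0 \<le> ?c" by linarith
  have "q_exp a b p = nat ?c"
    unfolding q_exp_def one_le_quot_iff[OF assms]
    by (rule Least_equality) (use c in linarith)+
  then show ?thesis using c by simp
qed

lemma le_q_exp:
  assumes "1 < a" "a < b"
  shows "p \<le> q_exp a b p"
proof -
  have "real p \<le> real p * (ln (real_of_int b) / ln (real_of_int a))"
    using assms by (intro mult_le_cancel_left1[THEN iffD2]) auto
  also have "\<dots> \<le> of_int \<lceil>real p * ln (real_of_int b) / ln (real_of_int a)\<rceil>"
    by (metis le_of_int_ceiling times_divide_eq_right)
  also have "\<dots> = real (q_exp a b p)"
    using q_exp_eq_ceiling[OF assms, of p] by (metis of_int_of_nat_eq)
  finally show ?thesis by simp
qed

text \<open>For \<open>1 < a < b\<close> the natural-number subtraction does not truncate, by \<open>le_q_exp\<close>.\<close>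

definition d :: "int \<Rightarrow> int \<Rightarrow> nat \<Rightarrow> nat" where
  "d a b p = q_exp a b p - p"

definition phi :: "int \<Rightarrow> int \<Rightarrow> nat \<Rightarrow> real" where
  "phi a b p = real_of_int a ^ (p + d a b p) / real_of_int b ^ p"

definition min_record_holder :: "int \<Rightarrow> int \<Rightarrow> real \<Rightarrow> bool" where
  "min_record_holder a b x \<longleftrightarrow>
     (\<exists>p\<ge>1. x = phi a b p \<and> phi a b p = Inf {phi a b p' | p'. 1 \<le> p' \<and> p' \<le> p})"

definition max_record_holder :: "int \<Rightarrow> int \<Rightarrow> real \<Rightarrow> bool" where
  "max_record_holder a b x \<longleftrightarrow>
     (\<exists>p\<ge>1. x = phi a b p \<and> phi a b p = Sup {phi a b p' | p'. 1 \<le> p' \<and> p' \<le> p})"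

primrec uv_seq :: "int \<Rightarrow> int \<Rightarrow> nat \<Rightarrow> real \<times> real" where
  "uv_seq a b 0 = (phi a b 1, phi a b 1)"
| "uv_seq a b (Suc i) =
     (let (u, v) = uv_seq a b i in
      if u * v < real_of_int a then (u, u * v) else (1 / real_of_int a * (u * v), v))"

definition u_seq :: "int \<Rightarrow> int \<Rightarrow> nat \<Rightarrow> real" where
  "u_seq a b i = fst (uv_seq a b i)"

definition v_seq :: "int \<Rightarrow> int \<Rightarrow> nat \<Rightarrow> real" where
  "v_seq a b i = snd (uv_seq a b i)"

end

theory Submission
  imports Defs
begin

text \<open>
  Since \<open>phi p\<close> is the unique element of \<open>[1, a)\<close> of the form \<open>a^n / b^p\<close>, the function \<open>phi\<close> is
  a homomorphism into \<open>[1, a)\<close> with multiplication modulo \<open>a\<close>. The pair \<open>(u\<^sub>i, v\<^sub>i)\<close> equals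
  \<open>(phi s, phi t)\<close> for indices that start at \<open>(1, 1)\<close> and become \<open>(s, s + t)\<close> or \<open>(s + t, t)\<close>,
  and all values \<open>phi p\<close> with \<open>1 \<le> p < s + t\<close> lie in \<open>[u\<^sub>i, v\<^sub>i]\<close>. If \<open>u\<^sub>i v\<^sub>i < a\<close>, then for
  \<open>s + t \<le> p < 2 s + t\<close> the bound \<open>phi (p - s) \<le> v\<^sub>i\<close> shows that \<open>phi p = u\<^sub>i phi (p - s)\<close>
  without reduction, so that \<open>u\<^sub>i < phi p \<le> u\<^sub>i v\<^sub>i = phi (s + t)\<close>: no new minimum record appears,
  and the only new maximum record is \<open>u\<^sub>i v\<^sub>i\<close>. The other case is symmetric.
\<close>

section \<open>Records as extreme values over finite index ranges\<close>

text \<open>The infimum runs over a finite nonempty set, so it is an attained minimum and the record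
  condition becomes a family of inequalities.\<close>

lemma min_record_holder_iff:
  "min_record_holder a b x \<longleftrightarrow> (\<exists>p\<ge>1. x = phi a b p \<and> (\<forall>p'\<in>{1..p}. phi a b p \<le> phi a b p'))"
proof -
  have "phi a b p = Inf {phi a b p' | p'. 1 \<le> p' \<and> p' \<le> p} \<longleftrightarrow>
      (\<forall>p'\<in>{1..p}. phi a b p \<le> phi a b p')" if "p \<ge> 1" for p
  proof -
    have eq: "{phi a b p' | p'. 1 \<le> p' \<and> p' \<le> p} = phi a b ` {1..p}"
      by auto
    show ?thesis
      unfolding eq using that
      by (subst cInf_eq_Min) (auto simp: eq_commute[of "phi a b p"] Min_eq_iff)
  qed
  then show ?thesis
    unfolding min_record_holder_def by blast
qed

lemma max_record_holder_iff:
  "max_record_holder a b x \<longleftrightarrow> (\<exists>p\<ge>1. x = phi a b p \<and> (\<forall>p'\<in>{1..p}. phi a b p' \<le> phi a b p))"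
proof -
  have "phi a b p = Sup {phi a b p' | p'. 1 \<le> p' \<and> p' \<le> p} \<longleftrightarrow>
      (\<forall>p'\<in>{1..p}. phi a b p' \<le> phi a b p)" if "p \<ge> 1" for p
  proof -
    have eq: "{phi a b p' | p'. 1 \<le> p' \<and> p' \<le> p} = phi a b ` {1..p}"
      by auto
    show ?thesis
      unfolding eq using that
      by (subst cSup_eq_Max) (auto simp: eq_commute[of "phi a b p"] Max_eq_iff)
  qed
  then show ?thesis
    unfolding max_record_holder_def by blast
qed

lemma u_seq_0: "u_seq a b 0 = phi a b 1" and v_seq_0: "v_seq a b 0 = phi a b 1"
  by (simp_all add: u_seq_def v_seq_def)

lemma uv_seq_Suc_less:
  assumes "u_seq a b i * v_seq a b i < real_of_int a"
  shows "u_seq a b (Suc i) = u_seq a b i" "v_seq a b (Suc i) = u_seq a b i * v_seq a b i"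
  using assms by (simp_all add: u_seq_def v_seq_def case_prod_beta)

lemma uv_seq_Suc_ge:
  assumes "real_of_int a \<le> u_seq a b i * v_seq a b i"
  shows "u_seq a b (Suc i) = u_seq a b i * v_seq a b i / real_of_int a"
    "v_seq a b (Suc i) = v_seq a b i"
  using assms by (simp_all add: u_seq_def v_seq_def case_prod_beta)

section \<open>Arithmetic of \<open>phi\<close> as reduction by powers of \<open>a\<close>\<close>

context
  fixes a b :: int
  assumes a_gt_1: "1 < a" and a_less_b: "a < b"
begin

text \<open>The admissible exponents form an up-set, so the least one decides every
  \<open>n\<close>. Both bounds on \<open>phi\<close> and its uniqueness rest on this.\<close>

lemma q_exp_le_iff: "q_exp a b p \<le> n \<longleftrightarrow> 1 \<le> real_of_int a ^ n / real_of_int b ^ p"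
  by (simp only: one_le_quot_iff[OF a_gt_1 a_less_b] q_exp_eq_ceiling[OF a_gt_1 a_less_b, symmetric]
      of_nat_le_iff)

lemma phi_eq: "phi a b p = real_of_int a ^ q_exp a b p / real_of_int b ^ p"
  using le_q_exp[OF a_gt_1 a_less_b, of p] by (simp add: phi_def d_def)

lemma phi_ge_1: "1 \<le> phi a b p"
  unfolding phi_eq using q_exp_le_iff by blast

lemma phi_less: "phi a b p < real_of_int a"
proof (cases "q_exp a b p")
  case 0
  then have "p = 0"
    using le_q_exp[OF a_gt_1 a_less_b, of p] by simp
  with 0 show ?thesis
    using a_gt_1 by (simp add: phi_eq)
next
  case (Suc n)
  then have "real_of_int a ^ n / real_of_int b ^ p < 1"
    using q_exp_le_iff[of p n] by simp
  then have "real_of_int a * (real_of_int a ^ n / real_of_int b ^ p) < real_of_int a * 1"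
    using a_gt_1 by (intro mult_strict_left_mono) auto
  then show ?thesis
    by (simp add: phi_eq Suc)
qed

text \<open>By minimality of \<open>q_exp\<close>, \<open>x\<close> is \<open>phi a b p\<close>
  times some \<open>a ^ k\<close>. Any \<open>k > 0\<close> would push \<open>x\<close> up to at
  least \<open>a\<close>.\<close>

lemma phi_eqI:
  assumes "x = real_of_int a ^ n / real_of_int b ^ p" "1 \<le> x" "x < real_of_int a"
  shows "phi a b p = x"
proof -
  have "q_exp a b p \<le> n"
    using assms q_exp_le_iff by simp
  then obtain k where n: "n = q_exp a b p + k"
    using le_Suc_ex by blast
  then have x: "x = phi a b p * real_of_int a ^ k"
    by (simp add: assms(1) phi_eq power_add)
  have "k = 0"
  proof (rule ccontr)
    assume "k \<noteq> 0"
    then have "real_of_int a \<le> real_of_int a ^ k"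
      using a_gt_1 by (intro self_le_power) auto
    also have "\<dots> \<le> x"
      using mult_right_mono[OF phi_ge_1, of "real_of_int a ^ k" p] a_gt_1 by (simp add: x)
    finally show False
      using assms(3) by simp
  qed
  then show ?thesis
    by (simp add: x)
qed

lemma phi_mult_eq:
  "phi a b p * phi a b p' = real_of_int a ^ (q_exp a b p + q_exp a b p') / real_of_int b ^ (p + p')"
  by (simp add: phi_eq power_add)

lemma phi_add_less:
  assumes "phi a b p * phi a b p' < real_of_int a"
  shows "phi a b (p + p') = phi a b p * phi a b p'"
  using assms mult_mono[OF phi_ge_1 phi_ge_1, of p p'] phi_ge_1[of p]
  by (intro phi_eqI[OF phi_mult_eq]) auto

lemma phi_add_ge:
  assumes "real_of_int a \<le> phi a b p * phi a b p'"
  shows "phi a b (p + p') = phi a b p * phi a b p' / real_of_int a"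
proof -
  obtain n where n: "q_exp a b p + q_exp a b p' = Suc n"
  proof (cases "q_exp a b p + q_exp a b p'")
    \<comment> \<open>A vanishing exponent sum forces both indices to be 0; the product is then 1,
      which is below \<open>a\<close>.\<close>
    case 0
    then have "p = 0" "p' = 0"
      using le_q_exp[OF a_gt_1 a_less_b, of p] le_q_exp[OF a_gt_1 a_less_b, of p'] by auto
    with 0 show ?thesis
      using assms a_gt_1 by (simp add: phi_eq)
  qed
  show ?thesis
  proof (rule phi_eqI[of _ n])
    show "phi a b p * phi a b p' / real_of_int a = real_of_int a ^ n / real_of_int b ^ (p + p')"
      using a_gt_1 by (simp add: phi_mult_eq n)
    show "1 \<le> phi a b p * phi a b p' / real_of_int a"
      using assms a_gt_1 by simp
    have "phi a b p * phi a b p' < real_of_int a * real_of_int a"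
      using phi_less phi_ge_1[of p] phi_ge_1[of p'] a_gt_1 by (intro mult_strict_mono) auto
    then show "phi a b p * phi a b p' / real_of_int a < real_of_int a"
      using a_gt_1 by (simp add: divide_less_eq)
  qed
qed

text \<open>The value 1 would equate a power of \<open>a\<close> with \<open>b ^ p\<close>, a number
  above 1 that would be coprime to itself. The strict bound is what excludes repeated minimum
  records.\<close>

lemma phi_gt_1:
  assumes "coprime a b" "1 \<le> p"
  shows "1 < phi a b p"
proof -
  have "phi a b p \<noteq> 1"
  proof
    assume "phi a b p = 1"
    then have "real_of_int a ^ q_exp a b p = real_of_int b ^ p"
      using a_gt_1 a_less_b by (simp add: phi_eq)
    then have "a ^ q_exp a b p = b ^ p"
      by (metis of_int_eq_iff of_int_power)
    moreover have "coprime (a ^ q_exp a b p) (b ^ p)"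
      using assms(1) by simp
    ultimately have "b ^ p = 1"
      using a_gt_1 a_less_b by simp
    moreover have "1 < b ^ p"
      using assms(2) a_gt_1 a_less_b by (intro one_less_power) auto
    ultimately show False
      by simp
  qed
  then show ?thesis
    using phi_ge_1[of p] by simp
qed

section \<open>The invariant along the recursion\<close>

text \<open>The clause \<open>i < s + t\<close> makes the covered indices exhaust all positive
  integers as \<open>i\<close> grows. The range clauses carry along that every record met so far is
  a term of the sequences.\<close>

lemma record_invariant:
  assumes "coprime a b"
  shows "\<exists>s t. s \<ge> 1 \<and> t \<ge> 1 \<and> i < s + t \<and> u_seq a b i = phi a b s \<and> v_seq a b i = phi a b t \<and>
    (\<forall>p. 1 \<le> p \<and> p < s + t \<longrightarrow>
      phi a b s \<le> phi a b p \<and> phi a b p \<le> phi a b t \<and>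
      ((\<forall>p'\<in>{1..p}. phi a b p \<le> phi a b p') \<longrightarrow> phi a b p \<in> range (u_seq a b)) \<and>
      ((\<forall>p'\<in>{1..p}. phi a b p' \<le> phi a b p) \<longrightarrow> phi a b p \<in> range (v_seq a b)))"
proof (induction i)
  case 0
  have "phi a b (Suc 0) \<in> range (u_seq a b)" "phi a b (Suc 0) \<in> range (v_seq a b)"
    using rangeI[of "u_seq a b" 0] rangeI[of "v_seq a b" 0] by (simp_all add: u_seq_0 v_seq_0)
  moreover have only_1: "1 \<le> p \<and> p < Suc 0 + Suc 0 \<longleftrightarrow> p = Suc 0" for p
    by auto
  ultimately show ?case
    by (intro exI[of _ "Suc 0"]) (simp add: only_1[simplified] u_seq_0 v_seq_0)
next
  case (Suc i)
  let ?min = "\<lambda>p. \<forall>p'\<in>{1..p}. phi a b p \<le> phi a b p'"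
  let ?max = "\<lambda>p. \<forall>p'\<in>{1..p}. phi a b p' \<le> phi a b p"
  from Suc obtain s t where st: "s \<ge> 1" "t \<ge> 1" "i < s + t"
    and u: "u_seq a b i = phi a b s" and v: "v_seq a b i = phi a b t"
    and le: "\<And>p. 1 \<le> p \<Longrightarrow> p < s + t \<Longrightarrow> phi a b s \<le> phi a b p"
    and ge: "\<And>p. 1 \<le> p \<Longrightarrow> p < s + t \<Longrightarrow> phi a b p \<le> phi a b t"
    and mn: "\<And>p. 1 \<le> p \<Longrightarrow> p < s + t \<Longrightarrow> ?min p \<Longrightarrow> phi a b p \<in> range (u_seq a b)"
    and mx: "\<And>p. 1 \<le> p \<Longrightarrow> p < s + t \<Longrightarrow> ?max p \<Longrightarrow> phi a b p \<in> range (v_seq a b)"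
    by blast
  have pos: "phi a b p > 0" for p
    using phi_ge_1[of p] by simp
  show ?case
  proof (cases "phi a b s * phi a b t < real_of_int a")
    case True
    note sum = phi_add_less[OF True]
    have us: "u_seq a b (Suc i) = phi a b s" and vs: "v_seq a b (Suc i) = phi a b (s + t)"
      using uv_seq_Suc_less[of a b i] True by (simp_all add: u v sum)
    have "phi a b s \<le> phi a b p \<and> phi a b p \<le> phi a b (s + t) \<and>
        (?min p \<longrightarrow> phi a b p \<in> range (u_seq a b)) \<and> (?max p \<longrightarrow> phi a b p \<in> range (v_seq a b))"
      if p: "1 \<le> p" "p < s + (s + t)" for p
    proof (cases "p < s + t")
      case True
      have "phi a b p \<le> phi a b t"
        using ge True p by blast
      also have "\<dots> \<le> phi a b (s + t)"
        using mult_right_mono[OF phi_ge_1, of "phi a b t" s] pos[of t] by (simp add: sum)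
      finally show ?thesis
        using le mn mx True p by blast
    next
      case False
      define r where "r = p - s"
      have r: "p = s + r" "1 \<le> r" "r < s + t"
        using False p st by (auto simp: r_def)
      have prod_le: "phi a b s * phi a b r \<le> phi a b s * phi a b t"
        using ge[OF r(2,3)] pos[of s] by simp
      then have pr: "phi a b p = phi a b s * phi a b r"
        unfolding r(1) using \<open>phi a b s * phi a b t < real_of_int a\<close> by (intro phi_add_less) simp
      have gt: "phi a b s < phi a b p"
        using phi_gt_1[OF assms r(2)] pos[of s] by (simp add: pr)
      have upper: "phi a b p \<le> phi a b (s + t)"
        using prod_le by (simp add: pr sum)
      \<comment> \<open>The earlier index \<open>s\<close> has a strictly smaller value.\<close>
      have "\<not> ?min p"
        using gt st r(1) by (auto simp: not_le intro!: bexI[of _ s])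
      moreover have "phi a b p \<in> range (v_seq a b)" if "?max p"
      proof -
        \<comment> \<open>A maximum record at \<open>p\<close> must reach the value at
          \<open>s + t \<le> p\<close>. Equality of values is enough, as records are compared by
          value and not by index.\<close>
        have "phi a b (s + t) \<le> phi a b p"
          using that False st by auto
        with upper have "phi a b p = v_seq a b (Suc i)"
          by (simp add: vs)
        then show ?thesis
          by (rule range_eqI)
      qed
      ultimately show ?thesis
        using gt upper by auto
    qed
    then show ?thesis
      using st us vs by (intro exI[of _ s] exI[of _ "s + t"]) auto
  next
    case False
    then have ge_a: "real_of_int a \<le> phi a b s * phi a b t"
      by simp
    note sum = phi_add_ge[OF ge_a]
    have us: "u_seq a b (Suc i) = phi a b (s + t)" and vs: "v_seq a b (Suc i) = phi a b t"
      using uv_seq_Suc_ge[of a b i] ge_a by (simp_all add: u v sum)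
    have "phi a b (s + t) \<le> phi a b p \<and> phi a b p \<le> phi a b t \<and>
        (?min p \<longrightarrow> phi a b p \<in> range (u_seq a b)) \<and> (?max p \<longrightarrow> phi a b p \<in> range (v_seq a b))"
      if p: "1 \<le> p" "p < (s + t) + t" for p
    proof (cases "p < s + t")
      case True
      have "phi a b (s + t) \<le> phi a b s"
        using phi_less[of t] pos[of s] a_gt_1 by (simp add: sum divide_le_eq)
      also have "\<dots> \<le> phi a b p"
        using le True p by blast
      finally show ?thesis
        using ge mn mx True p by blast
    next
      case False
      \<comment> \<open>The induction hypothesis covers \<open>r\<close>, and
        \<open>phi a b s \<le> phi a b r\<close> keeps the product with \<open>phi a b t\<close> at
        least \<open>a\<close>. So one division by \<open>a\<close> is due, and
        \<open>phi a b r < a\<close> makes the result strictly smaller than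
        \<open>phi a b t\<close>.\<close>
      define r where "r = p - t"
      have r: "p = r + t" "1 \<le> r" "r < s + t"
        using False p st by (auto simp: r_def)
      have prod_le: "phi a b s * phi a b t \<le> phi a b r * phi a b t"
        using le[OF r(2,3)] pos[of t] by simp
      then have pr: "phi a b p = phi a b r * phi a b t / real_of_int a"
        unfolding r(1) using ge_a by (intro phi_add_ge) simp
      have less: "phi a b p < phi a b t"
        using phi_less[of r] pos[of t] a_gt_1 by (simp add: pr divide_less_eq)
      have lower: "phi a b (s + t) \<le> phi a b p"
        using prod_le a_gt_1 by (simp add: pr sum divide_right_mono)
      have "\<not> ?max p"
        using less st r(1) by (auto simp: not_le intro!: bexI[of _ t])
      moreover have "phi a b p \<in> range (u_seq a b)" if "?min p"
      proof -
        have "phi a b p \<le> phi a b (s + t)"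
          using that False st by auto
        with lower have "phi a b p = u_seq a b (Suc i)"
          by (simp add: us)
        then show ?thesis
          by (rule range_eqI)
      qed
      ultimately show ?thesis
        using less lower by auto
    qed
    then show ?thesis
      using st us vs by (intro exI[of _ "s + t"] exI[of _ t]) auto
  qed
qed

end

theorem theorem5p2:
  fixes a b :: int
  assumes "coprime a b" and "1 < a" and "a < b"
  shows "range (u_seq a b) = {x. min_record_holder a b x}
       \<and> range (v_seq a b) = {x. max_record_holder a b x}"
proof -
  note inv = record_invariant[OF assms(2,3,1)]
  have "min_record_holder a b (u_seq a b i)" and "max_record_holder a b (v_seq a b i)" for i
  proof -
    \<comment> \<open>Since \<open>s\<close> and \<open>t\<close> are positive,
      \<open>{1..s}\<close> and \<open>{1..t}\<close> lie below \<open>s + t\<close>, where the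
      bounds hold.\<close>
    obtain s t where st: "s \<ge> 1" "t \<ge> 1" "u_seq a b i = phi a b s" "v_seq a b i = phi a b t"
      "\<And>p. 1 \<le> p \<Longrightarrow> p < s + t \<Longrightarrow> phi a b s \<le> phi a b p \<and> phi a b p \<le> phi a b t"
      using inv[of i] by blast
    show "min_record_holder a b (u_seq a b i)"
      unfolding min_record_holder_iff using st by (intro exI[of _ s]) auto
    show "max_record_holder a b (v_seq a b i)"
      unfolding max_record_holder_iff using st by (intro exI[of _ t]) auto
  qed
  moreover have "x \<in> range (u_seq a b)" if x: "min_record_holder a b x" for x
  proof -
    obtain p where p: "p \<ge> 1" "x = phi a b p" "\<forall>p'\<in>{1..p}. phi a b p \<le> phi a b p'"
      using x unfolding min_record_holder_iff by blast
    \<comment> \<open>Stage \<open>p\<close> is late enough: there \<open>p < s + t\<close>.\<close>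
    from inv[of p] show ?thesis
      by (elim exE conjE allE[of _ p]) (use p in simp)
  qed
  moreover have "x \<in> range (v_seq a b)" if x: "max_record_holder a b x" for x
  proof -
    obtain p where p: "p \<ge> 1" "x = phi a b p" "\<forall>p'\<in>{1..p}. phi a b p' \<le> phi a b p"
      using x unfolding max_record_holder_iff by blast
    from inv[of p] show ?thesis
      by (elim exE conjE allE[of _ p]) (use p in simp)
  qed
  ultimately show ?thesis
    by blast
qed

end
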